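(* Let $(X,\|\cdot\|)$ be a normed space, let $n\ge 2$, let $v_1,\ldots,v_n\in X$ be distinct vectors, and let $|||\cdot|||$ be a norm on $X^n$. Suppose that there is $\gamma>0$ with $|||(u,\ldots,u)|||\le\gamma\|u\|$ for all $u\in X$. Let $\mathrm{Sol}$ be the set of all global minimizers over $u\in X$ of $f(u):=|||(u-v_1,\ldots,u-v_n)|||$. Then a vector $\bar u\in X$ belongs to $\mathrm{Sol}$ if and only if there exist $x_1^*,\ldots,x_n^*\in X^*$ such that $$\sum_{i=1}^n x_i^*=0,\qquad |||(x_1^*,\ldots,x_n^* )|||^*=1,\qquad \sum_{i=1}^n\langle x_i^*,\bar u-v_i\rangle=|||(\bar u-v_1,\ldots,\bar u-v_n)|||.$$ Moreover, for such $\bar u\in\mathrm{Sol}$ and $x_1^*,\ldots,x_n^*\in X^*$ satisfying these three conditions, $$\mathrm{Sol}=\Big\{u\in X\;\Big|\;\sum_{i=1}^n\langle x_i^*,u-v_i\rangle=|||(u-v_1,\ldots,u-v_n)|||\Big\}.$$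
   Context: $X^*$ is the topological dual of $X$. An element $(x_1^*,\ldots,x_n^* )\in(X^* )^n$ acts on $X^n$ by $\langle (x_1^*,\ldots,x_n^* ),(x_1,\ldots,x_n)\rangle=\sum_{i=1}^n\langle x_i^*,x_i\rangle$. $|||\cdot|||^*$ denotes the dual norm of $|||\cdot|||$, i.e. $|||x^*|||^*=\sup\{\langle x^*,x\rangle: x\in X^n,\ |||x|||\le 1\}$ for $x^*\in(X^* )^n$.
   Formalization: The "only if" direction is proved under the added assumption that |||·||| is continuous for the product topology of X^n; without it that direction fails for some norms on infinite-dimensional X. The "if" direction and the "Moreover" part need no such assumption. *)

theory Defs
  imports "HOL-Analysis.Analysis"
begin

text \<open>
  The power \<open>X\<^sup>n\<close> is \<^typ>\<open>'a ^ 'n\<close> with \<open>n = CARD('n)\<close>, and \<open>X\<^sup>*\<close> is \<^typ>\<open>'a \<Rightarrow>\<^sub>L real\<close>. The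
  triple norm on \<open>X\<^sup>n\<close> is a function \<open>N\<close>; it is unrelated to the Euclidean-type norm that the
  library puts on \<^typ>\<open>'a ^ 'n\<close>, of which only the induced (product) topology is ever used.
\<close>

definition is_norm :: "('b::real_vector \<Rightarrow> real) \<Rightarrow> bool" where
  "is_norm N \<longleftrightarrow>
     (\<forall>x. 0 \<le> N x) \<and>
     (\<forall>x. N x = 0 \<longleftrightarrow> x = 0) \<and>
     (\<forall>c x. N (c *\<^sub>R x) = \<bar>c\<bar> * N x) \<and>
     (\<forall>x y. N (x + y) \<le> N x + N y)"

definition pairing :: "('a::real_normed_vector \<Rightarrow>\<^sub>L real) ^ 'n \<Rightarrow> 'a ^ 'n \<Rightarrow> real" where
  "pairing xs x = (\<Sum>i\<in>UNIV. blinfun_apply (xs $ i) (x $ i))"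

text \<open>
  The supremum is taken in the extended reals: \<open>N\<close> need not dominate the product norm, so it
  may be infinite for some elements of \<open>(X\<^sup>*)\<^sup>n\<close>.
\<close>

definition dual_norm ::
    "('a::real_normed_vector ^ 'n \<Rightarrow> real) \<Rightarrow> ('a \<Rightarrow>\<^sub>L real) ^ 'n \<Rightarrow> ereal" where
  "dual_norm N xs = (SUP x\<in>{x. N x \<le> 1}. ereal (pairing xs x))"

definition shift :: "'a::real_normed_vector ^ 'n \<Rightarrow> 'a \<Rightarrow> 'a ^ 'n" where
  "shift v u = (\<chi> i. u - v $ i)"

definition Sol :: "('a::real_normed_vector ^ 'n \<Rightarrow> real) \<Rightarrow> 'a ^ 'n \<Rightarrow> 'a set" where
  "Sol N v = {u. \<forall>w. N (shift v u) \<le> N (shift v w)}"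

definition optimality_conditions ::
    "('a::real_normed_vector ^ 'n \<Rightarrow> real) \<Rightarrow> 'a ^ 'n \<Rightarrow> 'a \<Rightarrow> ('a \<Rightarrow>\<^sub>L real) ^ 'n \<Rightarrow> bool" where
  "optimality_conditions N v u xs \<longleftrightarrow>
     (\<Sum>i\<in>UNIV. xs $ i) = 0 \<and>
     dual_norm N xs = 1 \<and>
     pairing xs (shift v u) = N (shift v u)"

text \<open>
  The necessity half of the optimality criterion needs \<open>N\<close> to be continuous for the product
  topology of \<open>X\<^sup>n\<close>; equivalently, the components of every \<open>N\<close>-bounded linear functional on \<open>X\<^sup>n\<close>
  have to lie in \<open>X\<^sup>*\<close>. An estimate for \<open>N\<close> on the diagonal alone does not give this. Let \<open>\<phi>\<close> be
  a discontinuous linear functional on \<open>X\<close>, let \<open>n = 2\<close>, \<open>v = (0, w)\<close> with \<open>\<phi> w \<noteq> 0\<close>, and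
  \<open>N (x, y) = \<parallel>x + y\<parallel> + \<parallel>x - y\<parallel> + \<bar>\<phi> (x - y)\<bar>\<close>, so that \<open>N (u, u) = 2 \<parallel>u\<parallel>\<close>. Then
  \<open>w / 2\<close> is a minimizer. The optimality conditions would give a continuous \<open>a\<close> with
  \<open>\<bar>a x\<bar> \<le> \<parallel>x\<parallel> + \<bar>\<phi> x\<bar>\<close> for all \<open>x\<close> and \<open>a w = \<parallel>w\<parallel> + \<bar>\<phi> w\<bar>\<close>; but the kernel of \<open>\<phi>\<close> is dense,
  so \<open>\<bar>a x\<bar> \<le> \<parallel>x\<parallel>\<close> for all \<open>x\<close>, a contradiction.
  In the theorem, continuity of \<open>N\<close> is therefore a premise of that implication, and of
  nothing else.
\<close>

end

theory Submission
  imports Defs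
begin

text \<open>
  If \<open>\<Sum>i. x\<^sub>i\<^sup>* = 0\<close>, the pairing with \<open>(u - v\<^sub>1, \<dots>, u - v\<^sub>n)\<close> does not depend on \<open>u\<close>, and dual norm
  \<open>1\<close> makes it a lower bound for \<open>f\<close>; this gives sufficiency and the description of the solution set.
  For necessity, minimality of \<open>ubar\<close> says that on the span of the diagonal and of
  \<open>y = (ubar - v\<^sub>1, \<dots>, ubar - v\<^sub>n)\<close> the functional \<open>(u, \<dots>, u) + t y \<mapsto> t N y\<close> is dominated by \<open>N\<close>. It is
  extended by the Hahn-Banach theorem, here in the Mazur-Orlicz form and obtained from minimal
  sublinear functionals; continuity of \<open>N\<close> makes the components of the extension continuous.
\<close>

section \<open>Sublinear functionals\<close>

definition sublinear :: "('b::real_vector \<Rightarrow> real) \<Rightarrow> bool" where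
  "sublinear p \<longleftrightarrow> (\<forall>x y. p (x + y) \<le> p x + p y) \<and> (\<forall>c\<ge>0. \<forall>x. p (c *\<^sub>R x) = c * p x)"

lemma sublinear_add: "sublinear p \<Longrightarrow> p (x + y) \<le> p x + p y"
  and sublinear_scaleR: "sublinear p \<Longrightarrow> c \<ge> 0 \<Longrightarrow> p (c *\<^sub>R x) = c * p x"
  by (auto simp: sublinear_def)

lemma sublinear_zero: "sublinear p \<Longrightarrow> p 0 = 0"
  using sublinear_scaleR[of p 0 0] by simp

lemma sublinear_minus_ge: "sublinear p \<Longrightarrow> - p (- x) \<le> p x"
  using sublinear_add[of p x "- x"] sublinear_zero[of p] by simp

text \<open>The reverse inequality comes for free: apply \<open>scale\<close> to
  \<open>inverse c\<close> and the point \<open>c *\<^sub>R x\<close>.\<close>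

lemma sublinearI:
  assumes add: "\<And>x y. p (x + y) \<le> p x + p y"
    and scale: "\<And>c x. c > 0 \<Longrightarrow> p (c *\<^sub>R x) \<le> c * p x"
  shows "sublinear p"
  unfolding sublinear_def
proof (intro conjI allI impI add)
  fix c :: real and x
  assume "c \<ge> 0"
  show "p (c *\<^sub>R x) = c * p x"
  proof (cases "c = 0")
    case True
    \<comment> \<open>The factor 2 gives \<open>p 0 \<ge> 0\<close> and the factor 1/2 gives
      \<open>p 0 \<le> 0\<close>.\<close>
    then show ?thesis using scale[of 2 0] scale[of "1/2" 0] by simp
  next
    case False
    then have "c > 0" using \<open>c \<ge> 0\<close> by simp
    have "p x \<le> inverse c * p (c *\<^sub>R x)"
      using scale[of "inverse c" "c *\<^sub>R x"] \<open>c > 0\<close> by simp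
    then have "c * p x \<le> p (c *\<^sub>R x)" using \<open>c > 0\<close> by (simp add: field_simps)
    then show ?thesis using scale[OF \<open>c > 0\<close>, of x] by simp
  qed
qed

text \<open>The index \<open>k\<close> may depend on the points, so the lemma serves both for
  families indexed by a cone, where indices are added and scaled, and for chains, where the smaller
  of two members is taken. \<open>bdd\<close> keeps the real infimum from being a meaningless
  default value.\<close>

lemma sublinear_INF:
  fixes f :: "'i \<Rightarrow> 'b::real_vector \<Rightarrow> real"
  assumes ne: "I \<noteq> {}"
    and bdd: "\<And>x. bdd_below ((\<lambda>i. f i x) ` I)"
    and add: "\<And>i j x y. i \<in> I \<Longrightarrow> j \<in> I \<Longrightarrow> \<exists>k\<in>I. f k (x + y) \<le> f i x + f j y"
    and scale: "\<And>i c x. i \<in> I \<Longrightarrow> c > 0 \<Longrightarrow> \<exists>k\<in>I. f k (c *\<^sub>R x) \<le> c * f i x"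
  shows "sublinear (\<lambda>x. INF i\<in>I. f i x)"
proof (rule sublinearI)
  fix x y
  have le: "(INF i\<in>I. f i (x + y)) \<le> f i x + f j y" if ij: "i \<in> I" "j \<in> I" for i j
    using add[OF ij, of x y] cINF_lower[OF bdd] by (meson order_trans)
  \<comment> \<open>The two infima are taken one after the other: first over \<open>j\<close> with
    \<open>i\<close> fixed, then over \<open>i\<close>.\<close>
  have "(INF i\<in>I. f i (x + y)) - f i x \<le> (INF j\<in>I. f j y)" if "i \<in> I" for i
    using le[OF that] by (intro cINF_greatest[OF ne]) (simp add: algebra_simps)
  then have "(INF i\<in>I. f i (x + y)) - (INF j\<in>I. f j y) \<le> (INF i\<in>I. f i x)"
    by (intro cINF_greatest[OF ne]) (simp add: algebra_simps)
  then show "(INF i\<in>I. f i (x + y)) \<le> (INF i\<in>I. f i x) + (INF i\<in>I. f i y)"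
    by simp
next
  fix c :: real and x
  assume c: "c > 0"
  have "(INF i\<in>I. f i (c *\<^sub>R x)) \<le> c * f i x" if "i \<in> I" for i
    using scale[OF that c, of x] cINF_lower[OF bdd] by (meson order_trans)
  then have "(INF i\<in>I. f i (c *\<^sub>R x)) / c \<le> (INF i\<in>I. f i x)"
    using c by (intro cINF_greatest[OF ne]) (simp add: field_simps)
  then show "(INF i\<in>I. f i (c *\<^sub>R x)) \<le> c * (INF i\<in>I. f i x)"
    using c by (simp add: field_simps)
qed

text \<open>Take \<open>q x\<close> to be the infimum of \<open>p (x + c) - s\<close> over
  \<open>(c, s)\<close> in \<open>C\<close>. It is finite because
  \<open>s \<le> p c \<le> p (x + c) + p (- x)\<close>, and sublinear because \<open>C\<close> is
  closed under sums and positive multiples.\<close>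

lemma sublinear_minorant_cone:
  fixes p :: "'b::real_vector \<Rightarrow> real" and C :: "('b \<times> real) set"
  assumes p: "sublinear p" and C: "convex_cone C"
    and le: "\<And>c s. (c, s) \<in> C \<Longrightarrow> s \<le> p c"
  obtains q where "sublinear q" "q \<le> p" "\<And>c s x. (c, s) \<in> C \<Longrightarrow> q x \<le> p (x + c) - s"
proof -
  define f where "f = (\<lambda>i x. p (x + fst i) - snd i)"
  define q where "q = (\<lambda>x. INF i\<in>C. f i x)"
  have bound: "- p (- x) \<le> f i x" if "i \<in> C" for i x
    using sublinear_add[OF p, of "x + fst i" "- x"] le[of "fst i" "snd i"] that
    by (simp add: f_def)
  have bdd: "bdd_below ((\<lambda>i. f i x) ` C)" for x
    using bound by (intro bdd_belowI2)
  have "sublinear q"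
    unfolding q_def
  proof (rule sublinear_INF[OF convex_cone_nonempty[OF C] bdd])
    fix i j x y
    assume "i \<in> C" "j \<in> C"
    then have "i + j \<in> C" by (rule convex_cone_add[OF C])
    moreover have "f (i + j) (x + y) \<le> f i x + f j y"
      using sublinear_add[OF p, of "x + fst i" "y + fst j"]
      by (simp add: f_def algebra_simps)
    ultimately show "\<exists>k\<in>C. f k (x + y) \<le> f i x + f j y" ..
  next
    fix i x and c :: real
    assume "i \<in> C" "c > 0"
    then have "c *\<^sub>R i \<in> C" by (intro convex_cone_scaleR[OF C]) auto
    moreover have "f (c *\<^sub>R i) (c *\<^sub>R x) \<le> c * f i x"
      using sublinear_scaleR[OF p, of c "x + fst i"] \<open>c > 0\<close>
      by (simp add: f_def algebra_simps)
    ultimately show "\<exists>k\<in>C. f k (c *\<^sub>R x) \<le> c * f i x" ..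
  qed
  moreover have q_le: "q x \<le> p (x + c) - s" if "(c, s) \<in> C" for c s x
    unfolding q_def using cINF_lower[OF bdd that] by (simp add: f_def)
  moreover have "q \<le> p"
  proof (rule le_funI)
    show "q x \<le> p x" for x
      using q_le[of 0 0] convex_cone_contains_0[OF C] by (simp add: zero_prod_def)
  qed
  ultimately show ?thesis using that by blast
qed

lemma convex_cone_ray: "convex_cone ((\<lambda>t. t *\<^sub>R z) ` {0..})"
proof -
  have "convex_cone {0::real..}"
    by (simp add: convex_cone_iff)
  moreover have "linear (\<lambda>t. t *\<^sub>R z)"
    by (intro linearI) (auto simp: algebra_simps)
  ultimately show ?thesis
    using convex_cone_linear_image by blast
qed

text \<open>Lowering \<open>m\<close> along the ray through \<open>(y, m y)\<close> cannot change
  it, by minimality; the bound on \<open>q\<close> then reads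
  \<open>m x \<le> m (x + y) - m y\<close>, the converse of subadditivity.\<close>

lemma linear_if_minimal_sublinear:
  assumes m: "sublinear m" and min: "\<And>q. sublinear q \<Longrightarrow> q \<le> m \<Longrightarrow> q = m"
  shows "linear m"
proof (rule linearI)
  show add: "m (x + y) = m x + m y" for x y
  proof -
    obtain q where "sublinear q" "q \<le> m"
      and q: "\<And>c s x. (c, s) \<in> (\<lambda>t. t *\<^sub>R (y, m y)) ` {0..} \<Longrightarrow> q x \<le> m (x + c) - s"
      by (rule sublinear_minorant_cone[OF m convex_cone_ray, of "(y, m y)"])
        (auto simp: sublinear_scaleR[OF m])
    then have "q = m" using min by blast
    moreover have "q x \<le> m (x + y) - m y"
      by (rule q) (auto intro!: image_eqI[of _ _ 1])
    ultimately show ?thesis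
      using sublinear_add[OF m, of x y] by simp
  qed
  have uminus: "m (- x) = - m x" for x
    using add[of x "- x"] sublinear_zero[OF m] by simp
  show "m (c *\<^sub>R x) = c *\<^sub>R m x" for c x
  proof (cases "c \<ge> 0")
    case False
    then show ?thesis
      using sublinear_scaleR[OF m, of "- c" x] uminus[of "c *\<^sub>R x"] by simp
  qed (simp add: sublinear_scaleR[OF m])
qed

text \<open>Zorn's lemma, for the reversed order, yields a minimal sublinear functional below
  \<open>p\<close>, which is linear. The pointwise infimum bounds a nonempty chain from
  below.\<close>

lemma exists_linear_le_sublinear:
  assumes p: "sublinear p"
  obtains F where "linear F" "F \<le> p"
proof -
  define A where "A = {q. sublinear q \<and> q \<le> p}"
  have "\<exists>m\<in>A. \<forall>q\<in>A. m \<ge> q \<longrightarrow> q = m"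
  proof (rule predicate_Zorn)
    show "partial_order_on A (relation_of (\<ge>) A)"
      by (rule partial_order_on_relation_ofI) auto
  next
    fix C
    assume "C \<in> Chains (relation_of (\<ge>) A)"
    then have sub: "C \<subseteq> A" and chain: "\<And>a b. a \<in> C \<Longrightarrow> b \<in> C \<Longrightarrow> a \<le> b \<or> b \<le> a"
      by (auto simp: Chains_def relation_of_def)
    show "\<exists>u\<in>A. \<forall>a\<in>C. a \<ge> u"
    proof (cases "C = {}")
      case True
      then show ?thesis using p by (auto simp: A_def)
    next
      case False
      \<comment> \<open>A bound independent of \<open>a\<close>:
        \<open>- p (- x) \<le> - a (- x) \<le> a x\<close>.\<close>
      have "- p (- x) \<le> a x" if "a \<in> C" for a x
      proof -
        have a: "sublinear a" "a \<le> p" using that sub by (auto simp: A_def)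
        show ?thesis
          using sublinear_minus_ge[OF a(1), of x] le_funD[OF a(2), of "- x"] by simp
      qed
      then have bdd: "bdd_below ((\<lambda>a. a x) ` C)" for x
        by (intro bdd_belowI2)
      define u where "u = (\<lambda>x. INF a\<in>C. a x)"
      have le: "u \<le> a" if "a \<in> C" for a
        unfolding u_def by (intro le_funI cINF_lower[OF bdd that])
      have "sublinear u"
        unfolding u_def
      proof (rule sublinear_INF[OF False bdd])
        fix a b x y
        assume ab: "a \<in> C" "b \<in> C"
        from chain[OF ab] show "\<exists>k\<in>C. k (x + y) \<le> a x + b y"
        proof
          assume "a \<le> b"
          then show ?thesis
            using sublinear_add[of a x y] sub ab le_funD[of a b y]
            by (intro bexI[of _ a]) (auto simp: A_def)
        next
          assume "b \<le> a"
          then show ?thesis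
            using sublinear_add[of b x y] sub ab le_funD[of b a x]
            by (intro bexI[of _ b]) (auto simp: A_def)
        qed
      next
        fix a x and c :: real
        assume "a \<in> C" "c > 0"
        then show "\<exists>k\<in>C. k (c *\<^sub>R x) \<le> c * a x"
          using sub sublinear_scaleR[of a c x] by (intro bexI[of _ a]) (auto simp: A_def)
      qed
      moreover have "u \<le> p"
        using False le sub by (auto simp: A_def intro: order_trans)
      ultimately show ?thesis
        using le by (auto simp: A_def)
    qed
  qed
  then obtain m where m: "sublinear m" "m \<le> p"
    and min: "\<And>q. sublinear q \<Longrightarrow> q \<le> p \<Longrightarrow> q \<le> m \<Longrightarrow> q = m"
    by (auto simp: A_def)
  have "linear m"
    using min m(2) by (intro linear_if_minimal_sublinear[OF m(1)]) (meson order_trans)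
  then show ?thesis using that m(2) by blast
qed

text \<open>A pair \<open>(c, s)\<close> in \<open>C\<close> prescribes the lower bound
  \<open>s\<close> at the point \<open>c\<close>. Since \<open>q (- c) \<le> p 0 - s = - s\<close>,
  every linear functional below \<open>q\<close> meets all these bounds.\<close>

theorem Mazur_Orlicz:
  fixes p :: "'b::real_vector \<Rightarrow> real" and C :: "('b \<times> real) set"
  assumes p: "sublinear p" and C: "convex_cone C"
    and le: "\<And>c s. (c, s) \<in> C \<Longrightarrow> s \<le> p c"
  obtains F where "linear F" "F \<le> p" "\<And>c s. (c, s) \<in> C \<Longrightarrow> s \<le> F c"
proof -
  obtain q where q: "sublinear q" "q \<le> p" "\<And>c s x. (c, s) \<in> C \<Longrightarrow> q x \<le> p (x + c) - s"
    using sublinear_minorant_cone[OF assms] by blast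
  obtain F where F: "linear F" "F \<le> q"
    using exists_linear_le_sublinear[OF q(1)] .
  have "s \<le> F c" if "(c, s) \<in> C" for c s
    using q(3)[OF that, of "- c"] le_funD[OF F(2), of "- c"] linear_neg[OF F(1), of c]
      sublinear_zero[OF p] by simp
  then show ?thesis using that F q(2) by (meson order_trans)
qed

section \<open>Norms on the power and their dual norms\<close>

lemma is_norm_nonneg: "is_norm N \<Longrightarrow> 0 \<le> N x"
  and is_norm_eq_0_iff: "is_norm N \<Longrightarrow> N x = 0 \<longleftrightarrow> x = 0"
  and is_norm_scaleR: "is_norm N \<Longrightarrow> N (c *\<^sub>R x) = \<bar>c\<bar> * N x"
  by (auto simp: is_norm_def)

lemma is_norm_imp_sublinear: "is_norm N \<Longrightarrow> sublinear N"
  by (simp add: is_norm_def sublinear_def)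

lemma pairing_scaleR: "pairing xs (c *\<^sub>R x) = c * pairing xs x"
  by (simp add: pairing_def blinfun.scaleR_right sum_distrib_left)

text \<open>The two shifts differ by the diagonal vector with entries \<open>u - w\<close>, on which
  the pairing is the value of the sum of the components.\<close>

lemma pairing_shift:
  assumes "(\<Sum>i\<in>UNIV. xs $ i) = 0"
  shows "pairing xs (shift v u) = pairing xs (shift v w)"
proof -
  have "(\<Sum>i\<in>UNIV. blinfun_apply (xs $ i) (u - w)) = blinfun_apply (\<Sum>i\<in>UNIV. xs $ i) (u - w)"
    by (simp add: blinfun.sum_left)
  then show ?thesis
    using assms by (simp add: pairing_def shift_def blinfun.diff_right sum_subtractf)
qed

lemma pairing_le_if_dual_norm_le_1:
  assumes N: "is_norm N" and le: "dual_norm N xs \<le> 1"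
  shows "pairing xs x \<le> N x"
proof (cases "x = 0")
  case True
  then show ?thesis using is_norm_nonneg[OF N, of x] by (simp add: pairing_def)
next
  case False
  then have pos: "N x > 0"
    using is_norm_nonneg[OF N, of x] is_norm_eq_0_iff[OF N, of x] by linarith
  then have "N (inverse (N x) *\<^sub>R x) \<le> 1" by (simp add: is_norm_scaleR[OF N])
  then have "ereal (pairing xs (inverse (N x) *\<^sub>R x)) \<le> dual_norm N xs"
    unfolding dual_norm_def by (intro SUP_upper) simp
  then have "pairing xs (inverse (N x) *\<^sub>R x) \<le> 1"
    using le by (metis ereal_less_eq(3) one_ereal_def order_trans)
  then show ?thesis using pos by (simp add: pairing_scaleR field_simps)
qed

text \<open>The supremum is attained at \<open>y\<close> divided by \<open>N y\<close>.\<close>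

lemma dual_norm_eq_1I:
  assumes N: "is_norm N" and le: "\<And>x. pairing xs x \<le> N x"
    and y: "y \<noteq> 0" "pairing xs y = N y"
  shows "dual_norm N xs = 1"
proof (rule antisym)
  show "dual_norm N xs \<le> 1"
    unfolding dual_norm_def
    by (intro SUP_least) (use le in \<open>auto intro: order_trans simp: one_ereal_def\<close>)
  have pos: "N y > 0"
    using y(1) is_norm_nonneg[OF N, of y] is_norm_eq_0_iff[OF N, of y] by linarith
  have "ereal (pairing xs (inverse (N y) *\<^sub>R y)) \<le> dual_norm N xs"
    unfolding dual_norm_def using pos by (intro SUP_upper) (simp add: is_norm_scaleR[OF N])
  then show "1 \<le> dual_norm N xs"
    using pos y(2) by (simp add: pairing_scaleR one_ereal_def)
qed

text \<open>A one-sided bound near 0 suffices, as linearity turns the bound at \<open>- x\<close>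
  into the opposite one at \<open>x\<close>.\<close>

lemma bounded_linear_if_le_continuous:
  fixes f :: "'a::real_normed_vector \<Rightarrow> real"
  assumes f: "linear f" and le: "\<And>x. f x \<le> g x" and g: "isCont g 0" "g 0 = 0"
  shows "bounded_linear f"
proof -
  obtain d where d: "d > 0" and "\<And>x. dist x 0 < d \<Longrightarrow> dist (g x) (g 0) < 1"
    using g(1) unfolding continuous_at_eps_delta by (metis zero_less_one)
  then have small: "f x \<le> 1" if "norm x < d" for x
    using le[of x] g(2) that by (fastforce simp: dist_real_def)
  have upper: "f x \<le> norm x * (2 / d)" for x
  proof (cases "x = 0")
    case False
    \<comment> \<open>The rescaled point has norm \<open>d / 2\<close>, inside the ball of radius
      \<open>d\<close>; this is the source of the constant \<open>2 / d\<close>.\<close>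
    have "f ((d / 2 / norm x) *\<^sub>R x) \<le> 1"
      using d False by (intro small) simp
    then show ?thesis
      using d False by (simp add: linear_scale[OF f] field_simps)
  qed (simp add: linear_0[OF f])
  have "norm (f x) \<le> norm x * (2 / d)" for x
    using upper[of x] upper[of "- x"] by (simp add: linear_neg[OF f] abs_le_iff)
  then show ?thesis
    using f unfolding bounded_linear_def bounded_linear_axioms_def by blast
qed

text \<open>The \<open>i\<close>-th component is \<open>F\<close> restricted to the
  \<open>i\<close>-th axis. There it is dominated by the restriction of \<open>N\<close>, which is
  continuous and vanishes at 0, so it lies in the dual of the base space.\<close>

lemma pairing_representation:
  fixes F :: "'a::real_normed_vector ^ 'n \<Rightarrow> real"
  assumes F: "linear F" and le: "\<And>x. F x \<le> N x"
    and N: "continuous_on UNIV N" "N 0 = 0"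
  obtains xs where "pairing xs = F"
proof -
  have "linear (axis i :: 'a \<Rightarrow> 'a ^ 'n)" for i
    by (intro linearI) (auto simp: axis_def vec_eq_iff)
  then have lin: "linear (\<lambda>u. F (axis i u))" for i
    using linear_compose[OF _ F] by (fastforce simp: o_def)
  have "continuous_on UNIV (\<lambda>u :: 'a. if j = i then u else 0)" for i j :: 'n
    by (cases "j = i") auto
  then have "continuous_on UNIV (\<lambda>u. N (axis i u))" for i
    unfolding axis_def
    by (intro continuous_on_compose2[OF N(1)] continuous_on_vec_lambda) auto
  then have bl: "bounded_linear (\<lambda>u. F (axis i u))" for i
    using lin le N(2)
    by (intro bounded_linear_if_le_continuous[where g = "\<lambda>u. N (axis i u)"])
      (auto simp: continuous_on_eq_continuous_at axis_eq_0_iff[THEN iffD2])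
  define xs where "xs = (\<chi> i. Blinfun (\<lambda>u. F (axis i u)))"
  have "pairing xs x = F x" for x
  proof -
    have "pairing xs x = F (\<Sum>i\<in>UNIV. axis i (x $ i))"
      by (simp add: pairing_def xs_def bounded_linear_Blinfun_apply[OF bl] linear_sum[OF F])
    also have "(\<Sum>i\<in>UNIV. axis i (x $ i)) = x"
      by (simp add: vec_eq_iff axis_def)
    finally show ?thesis .
  qed
  then show ?thesis using that by blast
qed

section \<open>The optimality criterion\<close>

text \<open>The pairing with \<open>shift v w\<close> is constant in \<open>w\<close> and bounds
  \<open>N (shift v w)\<close> from below. Equality at \<open>ubar\<close> makes this constant the
  minimum, so the minimizers are the points where equality holds.\<close>

lemma Sol_eq_if_optimality_conditions:
  assumes N: "is_norm N" and "optimality_conditions N v ubar xs"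
  shows "ubar \<in> Sol N v" "Sol N v = {u. pairing xs (shift v u) = N (shift v u)}"
proof -
  have sum0: "(\<Sum>i\<in>UNIV. xs $ i) = 0" and "dual_norm N xs = 1"
    and eq: "pairing xs (shift v ubar) = N (shift v ubar)"
    using assms(2) by (auto simp: optimality_conditions_def)
  then have "pairing xs x \<le> N x" for x
    by (intro pairing_le_if_dual_norm_le_1[OF N]) simp
  then have lower: "N (shift v ubar) \<le> N (shift v w)" for w
    using pairing_shift[OF sum0, of v ubar w] eq by metis
  then show "ubar \<in> Sol N v"
    by (simp add: Sol_def)
  have "u \<in> Sol N v \<longleftrightarrow> N (shift v u) = N (shift v ubar)" for u
    using lower by (force simp: Sol_def intro: antisym)
  then show "Sol N v = {u. pairing xs (shift v u) = N (shift v u)}"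
    using pairing_shift[OF sum0, of v ubar] eq by (metis (mono_tags, lifting) Collect_eqI Collect_mem_eq)
qed

lemma optimality_conditions_if_Sol:
  fixes N :: "'a::real_normed_vector ^ 'n \<Rightarrow> real"
  assumes N: "is_norm N" and cont: "continuous_on UNIV N"
    and Sol: "ubar \<in> Sol N v" and nz: "shift v ubar \<noteq> 0"
  shows "\<exists>xs. optimality_conditions N v ubar xs"
proof -
  define y where "y = shift v ubar"
  have N0: "N 0 = 0"
    using is_norm_eq_0_iff[OF N] by simp
  have min: "N y \<le> N (y + (\<chi> i. u))" for u
  proof -
    have "y + (\<chi> i. u) = shift v (ubar + u)"
      by (simp add: y_def shift_def vec_eq_iff)
    then show ?thesis using Sol by (simp add: Sol_def y_def)
  qed
  \<comment> \<open>The diagonal enters as a whole subspace with bound 0, which forces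
    \<open>F\<close> to vanish there; along \<open>y\<close> a ray suffices, since only
    \<open>F y \<ge> N y\<close> is needed.\<close>
  define C where "C = {((\<chi> i. u) + t *\<^sub>R y, t * N y) | u t. t \<ge> 0}"
  have C: "convex_cone C"
    unfolding convex_cone_iff
  proof (intro conjI ballI allI impI)
    show "0 \<in> C"
      by (auto simp: C_def zero_prod_def vec_eq_iff intro!: exI[of _ 0])
  next
    fix a b assume "a \<in> C" "b \<in> C"
    then obtain u t u' t' where "t \<ge> 0" "t' \<ge> 0"
      "a = ((\<chi> i. u) + t *\<^sub>R y, t * N y)" "b = ((\<chi> i. u') + t' *\<^sub>R y, t' * N y)"
      by (auto simp: C_def)
    then show "a + b \<in> C"
      unfolding C_def by (intro CollectI exI[of _ "u + u'"] exI[of _ "t + t'"])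
        (simp add: vec_eq_iff algebra_simps)
  next
    fix a and c :: real assume "a \<in> C" "c \<ge> 0"
    then obtain u t where "t \<ge> 0" "a = ((\<chi> i. u) + t *\<^sub>R y, t * N y)"
      by (auto simp: C_def)
    then show "c *\<^sub>R a \<in> C"
      using \<open>c \<ge> 0\<close> unfolding C_def by (intro CollectI exI[of _ "c *\<^sub>R u"] exI[of _ "c * t"])
        (simp add: vec_eq_iff algebra_simps)
  qed
  have le: "s \<le> N c" if "(c, s) \<in> C" for c s
  proof -
    obtain t u where t: "t \<ge> 0" and c: "c = (\<chi> i. u) + t *\<^sub>R y" and s: "s = t * N y"
      using \<open>(c, s) \<in> C\<close> unfolding C_def by blast
    show ?thesis
    proof (cases "t = 0")
      case True
      then show ?thesis using s is_norm_nonneg[OF N] by simp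
    next
      case False
      \<comment> \<open>Dividing by \<open>t > 0\<close> reduces the bound to minimality at
        \<open>ubar\<close> in the direction \<open>inverse t *\<^sub>R u\<close>.\<close>
      have "c = t *\<^sub>R (y + (\<chi> i. inverse t *\<^sub>R u))"
        using False by (simp add: c vec_eq_iff algebra_simps)
      then show ?thesis
        using t min[of "inverse t *\<^sub>R u"] by (simp add: s is_norm_scaleR[OF N] mult_left_mono)
    qed
  qed
  obtain F where F: "linear F" "F \<le> N" and FC: "\<And>c s. (c, s) \<in> C \<Longrightarrow> s \<le> F c"
    using Mazur_Orlicz[OF is_norm_imp_sublinear[OF N] C le] by blast
  obtain xs where xs: "pairing xs = F"
    using pairing_representation[OF F(1) le_funD[OF F(2)] cont N0] .
  have diag_ge: "0 \<le> F (\<chi> i. u)" for u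
    by (rule FC, unfold C_def, intro CollectI exI[of _ u] exI[of _ 0]) simp
  have diag: "F (\<chi> i. u) = 0" for u
  proof -
    have "(\<chi> i. - u) = - (\<chi> i::'n. u)" by (simp add: vec_eq_iff)
    then show ?thesis
      using diag_ge[of u] diag_ge[of "- u"] linear_neg[OF F(1), of "\<chi> i. u"] by simp
  qed
  have "blinfun_apply (\<Sum>i\<in>UNIV. xs $ i) u = 0" for u
    using diag[of u] by (simp add: pairing_def blinfun.sum_left flip: xs)
  then have "(\<Sum>i\<in>UNIV. xs $ i) = 0"
    by (intro blinfun_eqI) simp
  moreover have "N y \<le> F y"
    by (rule FC, unfold C_def, intro CollectI exI[of _ 0] exI[of _ 1]) (simp add: vec_eq_iff)
  then have eq: "pairing xs y = N y"
    using le_funD[OF F(2), of y] by (simp add: xs)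
  \<comment> \<open>Domination by \<open>N\<close> alone gives at most 1; the nonzero vector
    \<open>y\<close>, where equality holds, gives at least 1.\<close>
  moreover have "dual_norm N xs = 1"
    using nz eq le_funD[OF F(2)] by (intro dual_norm_eq_1I[OF N, of _ y]) (auto simp: xs y_def)
  ultimately show ?thesis
    by (auto simp: optimality_conditions_def y_def)
qed

text \<open>Otherwise \<open>u\<close> would equal two different vectors.\<close>

lemma shift_nonzero:
  assumes "i \<noteq> j" "v $ i \<noteq> v $ j"
  shows "shift v u \<noteq> 0"
  using assms by (auto simp: shift_def vec_eq_iff) (metis)

theorem theorem4p6:
  fixes N :: "'a::real_normed_vector ^ 'n \<Rightarrow> real"
    and v :: "'a ^ 'n"
    and \<gamma> :: real
    and ubar :: 'a
  assumes "CARD('n) \<ge> 2"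
    and "\<And>i j. i \<noteq> j \<Longrightarrow> v $ i \<noteq> v $ j"
    and "is_norm N"
    and "\<gamma> > 0"
    and "\<And>u. N (\<chi> i. u) \<le> \<gamma> * norm u"
  shows "((\<exists>xs. optimality_conditions N v ubar xs) \<longrightarrow> ubar \<in> Sol N v) \<and>
         (continuous_on UNIV N \<longrightarrow>
            ubar \<in> Sol N v \<longrightarrow> (\<exists>xs. optimality_conditions N v ubar xs)) \<and>
         (\<forall>xs. ubar \<in> Sol N v \<and> optimality_conditions N v ubar xs \<longrightarrow>
            Sol N v = {u. pairing xs (shift v u) = N (shift v u)})"
proof -
  obtain i j :: 'n where "i \<noteq> j"
    using assms(1) by (metis (full_types) UNIV_I card_2_iff' card_le_Suc0_iff_eq finite not_less_eq_eq numeral_2_eq_2)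
  then have "shift v ubar \<noteq> 0"
    using shift_nonzero assms(2) by blast
  then show ?thesis
    using Sol_eq_if_optimality_conditions[OF assms(3)] optimality_conditions_if_Sol[OF assms(3)]
    by blast
qed

end
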